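(* Let $p,q\ge 1$ and $1\le r\le p$ be integers. Every non-minimal linear self map of $D^r_{p,q}$ extends holomorphically to an open neighborhood (in $Gr(r,\mathbb C^{p+q})$) of the closure $\overline{D^r_{p,q}}:=D^r_{p,q}\cup\partial D^r_{p,q}$.
   Context: $M_n$ is the set of $n\times n$ complex matrices. $H_{p,q}=\begin{pmatrix}I_p&0\\0&-I_q\end{pmatrix}$ is the standard Hermitian form of signature $(p,q)$ on $\mathbb C^{p+q}$. For $1\le r\le p$, the generalized type-I domain $D^r_{p,q}\subset Gr(r,\mathbb C^{p+q})$ is the set of $r$-dimensional complex linear subspaces ($r$-planes) of $\mathbb C^{p+q}$ on which $H_{p,q}$ is positive definite; $\partial D^r_{p,q}$ is its boundary in the Grassmannian $Gr(r,\mathbb C^{p+q})$. The extension takes values in $Gr(r,\mathbb C^{p+q})$. A matrix $M\in M_{p+q}$ acts on column vectors by $z\mapsto Mz$. If the kernel of $M$ is negative semi-definite with respect to $H_{p,q}$ (equivalently, $M$ maps every positive definite $r$-plane onto an $r$-plane), $M$ induces a holomorphic map $D^r_{p,q}\to Gr(r,\mathbb C^{p+q})$, $P\mapsto M(P)$. A self map of $D^r_{p,q}$ is called a linear self map if it is induced in this way by some $M\in M_{p+q}$. A linear self map of $D^r_{p,q}$ is called minimal if it is given by a matrix of rank $p$, and non-minimal otherwise (every matrix inducing a linear self map has rank at least $p$). *)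

theory Defs
  imports "HOL-Analysis.Analysis"
begin

section \<open>The Grassmannian as a complex manifold\<close>

text \<open>
  Complex subspaces and complex dimension are those of the interpretation \<open>vec\<close>, i.e. they refer
  to the scalar multiplication \<open>*s\<close> (the unqualified \<open>subspace\<close> and \<open>dim\<close> are the real notions).
\<close>

definition Gr :: "nat \<Rightarrow> (complex^'n) set set" where
  "Gr r = {P. vec.subspace P \<and> vec.dim P = r}"

text \<open>
  The atlas consists of the graph charts: for a splitting \<open>V \<oplus> W\<close> of the ambient space with
  \<open>dim V = r\<close>, the space \<open>Hom(V, W)\<close> parametrizes the \<open>r\<close>-planes transversal to \<open>W\<close> by
  \<open>T \<mapsto> {v + T v | v \<in> V}\<close>. Linear maps \<open>V \<rightarrow> W\<close> are represented by the square matrices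
  extending them by zero on \<open>W\<close>; therefore \<open>hom_space\<close> depends on \<open>W\<close> only.
\<close>

definition splittings :: "nat \<Rightarrow> ((complex^'n) set \<times> (complex^'n) set) set" where
  "splittings r = {(V, W). V \<in> Gr r \<and> vec.subspace W \<and> V \<inter> W = {0} \<and>
     {v + w | v w. v \<in> V \<and> w \<in> W} = UNIV}"

definition hom_space :: "(complex^'n) set \<Rightarrow> (complex^'n^'n) set" where
  "hom_space W = {T. (\<forall>w\<in>W. T *v w = 0) \<and> (\<forall>z. T *v z \<in> W)}"

definition graph :: "(complex^'n) set \<Rightarrow> complex^'n^'n \<Rightarrow> (complex^'n) set" where
  "graph V T = (\<lambda>v. v + T *v v) ` V"

definition chart_domain :: "nat \<Rightarrow> (complex^'n) set \<Rightarrow> (complex^'n) set set" where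
  "chart_domain r W = {P \<in> Gr r. P \<inter> W = {0}}"

definition chart :: "(complex^'n) set \<Rightarrow> (complex^'n) set \<Rightarrow> (complex^'n) set \<Rightarrow> complex^'n^'n" where
  "chart V W = the_inv_into (hom_space W) (graph V)"

lemma projection_matrix_exists:
  fixes V W :: "(complex^'n) set"
  assumes V: "vec.subspace V" and W: "vec.subspace W" and 0: "V \<inter> W = {0}"
    and sum: "{v + w | v w. v \<in> V \<and> w \<in> W} = UNIV"
  obtains A :: "complex^'n^'n" where "\<And>z. A *v z \<in> V" "\<And>z. z - A *v z \<in> W"
    "\<And>v. v \<in> V \<Longrightarrow> A *v v = v" "\<And>w. w \<in> W \<Longrightarrow> A *v w = 0"
proof -
  have "\<exists>v. v \<in> V \<and> z - v \<in> W" for z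
  proof -
    have "z \<in> {v + w | v w. v \<in> V \<and> w \<in> W}" using sum by simp
    then show ?thesis by force
  qed
  then obtain a where a: "\<And>z. a z \<in> V" "\<And>z. z - a z \<in> W" by metis
  have uniq: "a z = v" if "v \<in> V" "z - v \<in> W" for z v
  proof -
    have "a z - v \<in> V" using a that V by (simp add: vec.subspace_diff)
    moreover have "(z - v) - (z - a z) \<in> W" using a that W by (meson vec.subspace_diff)
    ultimately have "a z - v \<in> V \<inter> W" by simp
    then show ?thesis using 0 by simp
  qed
  have lin: "Vector_Spaces.linear (*s) (*s) a"
  proof -
    have "a (x + y) = a x + a y" for x y
    proof -
      have "(x - a x) + (y - a y) \<in> W" using a W by (meson vec.subspace_add)
      then show ?thesis
        using a V by (intro uniq) (auto simp: vec.subspace_add algebra_simps)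
    qed
    moreover have "a (c *s x) = c *s a x" for c x
    proof -
      have "c *s (x - a x) \<in> W" using a W by (meson vec.subspace_scale)
      then show ?thesis
        using a V by (intro uniq) (auto simp: vec.subspace_scale vec.scale_right_diff_distrib)
    qed
    ultimately show ?thesis by (simp add: Vector_Spaces.linear_iff vec.vector_space_axioms)
  qed
  have A: "matrix a *v z = a z" for z using lin by (simp add: matrix_works)
  show ?thesis
  proof (rule that[of "matrix a"])
    show "matrix a *v v = v" if "v \<in> V" for v
      unfolding A using that W by (intro uniq) (auto simp: vec.subspace_0)
    show "matrix a *v w = 0" if "w \<in> W" for w
      unfolding A using that V by (intro uniq) (auto simp: vec.subspace_0)
  qed (use a A in auto)
qed

lemma graph_bij_betw:
  assumes "(V, W) \<in> splittings r"
  shows "bij_betw (graph V) (hom_space W) (chart_domain r W)"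
proof -
  have V: "vec.subspace V" "vec.dim V = r" and W: "vec.subspace W" and 0: "V \<inter> W = {0}"
    and sum: "{v + w | v w. v \<in> V \<and> w \<in> W} = UNIV"
    using assms by (auto simp: splittings_def Gr_def)
  obtain A :: "complex^'a^'a" where A: "\<And>z. A *v z \<in> V" "\<And>z. z - A *v z \<in> W"
    "\<And>v. v \<in> V \<Longrightarrow> A *v v = v" "\<And>w. w \<in> W \<Longrightarrow> A *v w = 0"
    using projection_matrix_exists[OF V(1) W 0 sum] by blast
  have AT: "A *v (v + T *v v) = v" if "T \<in> hom_space W" "v \<in> V" for T v
    using that A by (simp add: hom_space_def matrix_vector_right_distrib)
  show ?thesis
    unfolding bij_betw_def
  proof
    show "inj_on (graph V) (hom_space W)"
    proof
      fix S T assume S: "S \<in> hom_space W" and T: "T \<in> hom_space W" and eq: "graph V S = graph V T"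
      have *: "S *v v = T *v v" if v: "v \<in> V" for v
      proof -
        have "v + S *v v \<in> graph V T" using v eq by (auto simp: graph_def)
        then obtain v' where v': "v' \<in> V" "v + S *v v = v' + T *v v'" by (auto simp: graph_def)
        then have "v = v'" using AT[OF S v] AT[OF T v'(1)] by simp
        then show ?thesis using v' by simp
      qed
      have "S *v z = T *v z" for z
      proof -
        have "S *v (z - A *v z) = 0" "T *v (z - A *v z) = 0"
          using A(2)[of z] S T by (auto simp: hom_space_def)
        then have "S *v z = S *v (A *v z)" "T *v z = T *v (A *v z)"
          by (simp_all add: matrix_vector_mult_diff_distrib)
        then show ?thesis using *[OF A(1)] by simp
      qed
      then show "S = T" by (simp add: matrix_eq)
    qed
    show "graph V ` hom_space W = chart_domain r W"
    proof (intro equalityI subsetI)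
      fix P assume "P \<in> graph V ` hom_space W"
      then obtain T where T: "T \<in> hom_space W" and P: "P = graph V T" by auto
      define B where "B = mat 1 + T"
      have B: "P = (*v) B ` V"
        unfolding P graph_def B_def by (simp add: matrix_vector_mult_add_rdistrib)
      have "inj_on ((*v) B) V"
        using AT[OF T] unfolding B_def
        by (intro inj_on_inverseI[where g = "(*v) A"]) (simp add: matrix_vector_mult_add_rdistrib)
      then have "vec.dim P = r"
        unfolding B using V vec.dim_image_eq[of "(*v) B" V]
        by (metis matrix_vector_mul_linear_gen vec.span_eq_iff)
      moreover have "vec.subspace P"
        unfolding B using V by (simp add: vec.subspace_image)
      moreover have "P \<inter> W = {0}"
      proof -
        have "x = 0" if x: "x \<in> P" "x \<in> W" for x
        proof -
          obtain v where v: "v \<in> V" "x = v + T *v v" using x(1) unfolding P graph_def by blast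
          then have "v = 0" using AT[OF T v(1)] A(4)[OF x(2)] by simp
          then show ?thesis using v by simp
        qed
        then show ?thesis using \<open>vec.subspace P\<close> W by (auto simp: vec.subspace_0)
      qed
      ultimately show "P \<in> chart_domain r W" by (simp add: chart_domain_def Gr_def)
    next
      fix P assume "P \<in> chart_domain r W"
      then have P: "vec.subspace P" "vec.dim P = r" and P0: "P \<inter> W = {0}"
        by (auto simp: chart_domain_def Gr_def)
      have "vec.dim {x + y | x y. x \<in> P \<and> y \<in> W} = vec.dim (UNIV :: (complex^'a) set)"
        using vec.dim_sums_Int[OF P(1) W] vec.dim_sums_Int[OF V(1) W] 0 P0 sum P V by simp
      then have "{x + y | x y. x \<in> P \<and> y \<in> W} = UNIV"
        by (intro vec.subspace_dim_equal vec.subspace_sums[OF P(1) W] vec.subspace_UNIV) auto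
      then obtain B :: "complex^'a^'a" where B: "\<And>z. B *v z \<in> P" "\<And>z. z - B *v z \<in> W"
        "\<And>v. v \<in> P \<Longrightarrow> B *v v = v" "\<And>w. w \<in> W \<Longrightarrow> B *v w = 0"
        using projection_matrix_exists[OF P(1) W P0] by blast
      have BA: "(B - A) *v z = (z - A *v z) - (z - B *v z)" for z
        by (simp add: matrix_vector_mult_diff_rdistrib)
      have "(B - A) *v z \<in> W" for z
        unfolding BA using A(2) B(2) W by (meson vec.subspace_diff)
      then have hom: "B - A \<in> hom_space W"
        using A(4) B(4) by (auto simp: hom_space_def matrix_vector_mult_diff_rdistrib)
      have g: "v + (B - A) *v v = B *v v" if "v \<in> V" for v
        using that A(3) by (simp add: matrix_vector_mult_diff_rdistrib)
      have "graph V (B - A) = P"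
      proof (intro equalityI subsetI)
        fix x assume "x \<in> graph V (B - A)"
        then show "x \<in> P" using g B(1) by (auto simp: graph_def)
      next
        fix x assume x: "x \<in> P"
        have "B *v (x - A *v x) = 0" by (rule B(4)[OF A(2)])
        then have "B *v (A *v x) = x"
          using B(3)[OF x] by (simp add: matrix_vector_mult_diff_distrib)
        then show "x \<in> graph V (B - A)"
          unfolding graph_def using g[OF A(1)[of x]] A(1)[of x] by (intro image_eqI[where x = "A *v x"]) auto
      qed
      then show "P \<in> graph V ` hom_space W" using hom by blast
    qed
  qed
qed

definition Gr_topology :: "nat \<Rightarrow> (complex^'n) set topology" where
  "Gr_topology r = topology (\<lambda>U. U \<subseteq> Gr r \<and> (\<forall>(V, W) \<in> splittings r.
     openin (top_of_set (hom_space W)) {T \<in> hom_space W. graph V T \<in> U}))"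

lemma openin_Gr_topology:
  "openin (Gr_topology r) U \<longleftrightarrow> U \<subseteq> Gr r \<and> (\<forall>(V, W) \<in> splittings r.
     openin (top_of_set (hom_space W)) {T \<in> hom_space W. graph V T \<in> U})"
proof -
  have "istopology (\<lambda>U. U \<subseteq> Gr r \<and> (\<forall>(V, W) \<in> splittings r.
     openin (top_of_set (hom_space W)) {T \<in> hom_space W. graph V T \<in> U}))"
    (is "istopology ?L")
    unfolding istopology_def
  proof (rule conjI; intro allI impI)
    fix S T assume S: "?L S" and T: "?L T"
    have "openin (top_of_set (hom_space W)) {A \<in> hom_space W. graph V A \<in> S \<inter> T}"
      if "(V, W) \<in> splittings r" for V W
    proof -
      have "{A \<in> hom_space W. graph V A \<in> S \<inter> T} =
          {A \<in> hom_space W. graph V A \<in> S} \<inter> {A \<in> hom_space W. graph V A \<in> T}" by auto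
      then show ?thesis using S T that by auto
    qed
    then show "?L (S \<inter> T)" using S by auto
  next
    fix K assume K: "\<forall>S\<in>K. ?L S"
    have "openin (top_of_set (hom_space W)) {A \<in> hom_space W. graph V A \<in> \<Union>K}"
      if "(V, W) \<in> splittings r" for V W
    proof -
      have "{A \<in> hom_space W. graph V A \<in> \<Union>K} =
          (\<Union>S\<in>K. {A \<in> hom_space W. graph V A \<in> S})" by auto
      moreover have "openin (top_of_set (hom_space W)) (\<Union>S\<in>K. {A \<in> hom_space W. graph V A \<in> S})"
        using K that by (intro openin_Union) auto
      ultimately show ?thesis by simp
    qed
    then show "?L (\<Union>K)" using K by auto
  qed
  then show ?thesis unfolding Gr_topology_def by (rule fun_cong[OF topology_inverse'])
qed

lemma topspace_Gr_topology [simp]: "topspace (Gr_topology r) = Gr r"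
proof -
  have "{T \<in> hom_space W. graph V T \<in> Gr r} = hom_space W" if "(V, W) \<in> splittings r"
    for V W :: "(complex^'a) set"
    using bij_betw_apply[OF graph_bij_betw[OF that]] by (auto simp: chart_domain_def)
  then have "openin (Gr_topology r) (Gr r :: (complex^'a) set set)"
    by (auto simp: openin_Gr_topology)
  then show ?thesis
    by (metis openin_Gr_topology openin_subset openin_topspace subset_antisym)
qed

text \<open>
  Holomorphy of a matrix-valued function on a relatively open subset \<open>S\<close> of a complex linear
  space of matrices: complex differentiability at every point. The derivative is taken within
  \<open>S\<close>, so only the values of \<open>D\<close> on the linear space containing \<open>S\<close> matter.
\<close>

definition mat_holomorphic_on ::
    "(complex^'n^'n \<Rightarrow> complex^'n^'n) \<Rightarrow> (complex^'n^'n) set \<Rightarrow> bool" where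
  "mat_holomorphic_on f S \<longleftrightarrow> (\<forall>T\<in>S. \<exists>D. (f has_derivative D) (at T within S) \<and>
     (\<forall>c X. D (map_matrix ((*) c) X) = map_matrix ((*) c) (D X)))"

definition Gr_holomorphic_on ::
    "nat \<Rightarrow> ((complex^'n) set \<Rightarrow> (complex^'n) set) \<Rightarrow> (complex^'n) set set \<Rightarrow> bool" where
  "Gr_holomorphic_on r F U \<longleftrightarrow>
     openin (Gr_topology r) U \<and>
     continuous_map (subtopology (Gr_topology r) U) (Gr_topology r) F \<and>
     (\<forall>(V, W) \<in> splittings r. \<forall>(V', W') \<in> splittings r.
        mat_holomorphic_on (\<lambda>T. chart V' W' (F (graph V T)))
          {T \<in> hom_space W. graph V T \<in> U \<and> F (graph V T) \<in> chart_domain r W'})"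


section \<open>Generalized type-I domains and their linear self maps\<close>

text \<open>
  The signature \<open>(p, q)\<close> is \<open>(CARD('p), CARD('q))\<close>; both are at least 1 since types are nonempty.
\<close>

definition H_mat :: "complex^('p::finite + 'q::finite)^('p + 'q)" where
  "H_mat = (\<chi> i j. if i = j then (case i of Inl _ \<Rightarrow> 1 | Inr _ \<Rightarrow> -1) else 0)"

text \<open>The number \<open>z\<^sup>* H z\<close> is real because \<open>H\<close> is Hermitian; \<open>Re\<close> only changes its type.\<close>

definition H_form :: "complex^('p::finite + 'q::finite) \<Rightarrow> real" where
  "H_form z = Re (\<Sum>i\<in>UNIV. cnj (z $ i) * (H_mat *v z) $ i)"

definition H_pos_def :: "(complex^('p::finite + 'q::finite)) set \<Rightarrow> bool" where
  "H_pos_def P \<longleftrightarrow> (\<forall>z\<in>P. z \<noteq> 0 \<longrightarrow> H_form z > 0)"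

definition H_neg_semidef :: "(complex^('p::finite + 'q::finite)) set \<Rightarrow> bool" where
  "H_neg_semidef P \<longleftrightarrow> (\<forall>z\<in>P. H_form z \<le> 0)"

definition typeI_domain :: "nat \<Rightarrow> (complex^('p::finite + 'q::finite)) set set" where
  "typeI_domain r = {P \<in> Gr r. H_pos_def P}"

text \<open>Maps on the domain are total functions of which only the values on the domain matter.\<close>

definition induces ::
    "nat \<Rightarrow> complex^('p::finite + 'q::finite)^('p + 'q) \<Rightarrow>
     ((complex^('p + 'q)) set \<Rightarrow> (complex^('p + 'q)) set) \<Rightarrow> bool" where
  "induces r M f \<longleftrightarrow> H_neg_semidef {z. M *v z = 0} \<and>
     (\<forall>P\<in>typeI_domain r. f P = (\<lambda>z. M *v z) ` P)"

definition linear_self_map ::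
    "nat \<Rightarrow> ((complex^('p::finite + 'q::finite)) set \<Rightarrow> (complex^('p + 'q)) set) \<Rightarrow> bool" where
  "linear_self_map r f \<longleftrightarrow> f ` typeI_domain r \<subseteq> typeI_domain r \<and> (\<exists>M. induces r M f)"

definition minimal_linear_self_map ::
    "nat \<Rightarrow> ((complex^('p::finite + 'q::finite)) set \<Rightarrow> (complex^('p + 'q)) set) \<Rightarrow> bool" where
  "minimal_linear_self_map r f \<longleftrightarrow> linear_self_map r f \<and>
     (\<exists>M. induces r M f \<and> rank M = CARD('p))"

end

theory Submission
  imports Defs
begin

text \<open>
  A matrix inducing a self map sends positive vectors to positive vectors. If its kernel contained
  a nonzero null vector, its whole range would be positive semi-definite and the map would be
  minimal. So for a non-minimal map the negative semi-definite kernel meets every positive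
  semi-definite plane only in \<open>0\<close>; these planes form a closed set containing the domain. The planes
  meeting the kernel trivially form an open set, and there \<open>P \<mapsto> M(P)\<close> is given in charts by rational
  functions.
\<close>

section \<open>Linear algebra\<close>

text \<open>The only obstruction to extending is a nonzero null vector shared by the kernel and a
  boundary plane: a vector of a positive semi-definite plane that \<open>M\<close> kills has form
  value both \<ge> 0 and \<le> 0, and there the image plane drops dimension. Null kernel vectors are
  so restrictive because translating by a multiple of a null vector changes the form without a
  quadratic term, while \<open>M\<close> does not see the translation: a vector outside one
  hyperplane can thus be made positive with its image kept fixed. The self-map hypothesis speaks of
  planes only; turning it into a statement about vectors requires a positive \<open>r\<close>-plane
  through any given positive vector, and this is where 1 \<le> r \<le> p enters.\<close>

lemma matrix_vector_mult_axis:
  fixes A :: "'a::semiring_1^'n^'m"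
  shows "A *v axis j 1 = column j A"
  by (simp add: vec_eq_iff matrix_vector_mult_def axis_def column_def if_distrib[of "(*) _"] cong: if_cong)

text \<open>Expanding the columns over a basis \<open>B\<close> of the range factors
  \<open>A\<close> through a space of dimension \<open>card B\<close>. Read by rows, the same
  factorization writes every row as a combination of \<open>card B\<close> coefficient
  vectors.\<close>

lemma dim_rows_le_dim_range:
  fixes A :: "'a::field^'n^'m"
  shows "vec.dim (rows A) \<le> vec.dim (range ((*v) A))"
proof -
  obtain B where B: "B \<subseteq> range ((*v) A)" "vec.independent B"
    "range ((*v) A) \<subseteq> vec.span B" "card B = vec.dim (range ((*v) A))"
    by (rule vec.basis_exists)
  have fin: "finite B" using B(2) by (rule vec.finiteI_independent)
  define R where "R b j = vec.representation B (column j A) b" for b j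
  have entry: "A $ i $ j = (\<Sum>b\<in>B. R b j * b $ i)" for i j
  proof -
    have "column j A = A *v axis j 1" by (simp add: matrix_vector_mult_axis)
    then have "column j A \<in> vec.span B" using B(3) by (metis range_subsetD)
    then have "(\<Sum>b\<in>B. R b j *s b) = column j A"
      unfolding R_def using B(2) fin by (intro vec.sum_representation_eq) auto
    then have "(\<Sum>b\<in>B. R b j *s b) $ i = A $ i $ j" by (simp add: column_def)
    then show ?thesis by (simp add: sum_component)
  qed
  have "row i A = (\<Sum>b\<in>B. b $ i *s (\<chi> j. R b j))" for i
    by (simp add: vec_eq_iff row_def entry sum_component mult.commute)
  then have "row i A \<in> vec.span ((\<lambda>b. \<chi> j. R b j) ` B)" for i
    by (simp only:) (intro vec.span_sum vec.span_scale vec.span_base imageI)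
  then have "rows A \<subseteq> vec.span ((\<lambda>b. \<chi> j. R b j) ` B)" by (auto simp: rows_def)
  then have "vec.dim (rows A) \<le> card ((\<lambda>b. \<chi> j. R b j) ` B)"
    using fin by (intro vec.dim_le_card) auto
  then show ?thesis using B(4) card_image_le[OF fin, of "\<lambda>b. \<chi> j. R b j"] by linarith
qed

text \<open>\<open>rank\<close> is defined through rows, whereas the signature arguments bound the
  range. Using the preceding bound for \<open>A\<close> and for its transpose closes the cycle rows
  \<le> range \<le> columns \<le> rows of dimensions.\<close>

lemma vec_rank_dim_range:
  fixes A :: "'a::field^'n^'m"
  shows "rank A = vec.dim (range ((*v) A))"
proof -
  have range: "vec.dim (range ((*v) A)) \<le> vec.dim (columns A)" for A :: "'a^'k^'l"
  proof -
    have "A *v x \<in> vec.span (columns A)" for x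
      unfolding matrix_mult_sum
      by (intro vec.span_sum vec.span_scale vec.span_base) (auto simp: columns_def)
    then have "vec.dim (range ((*v) A)) \<le> vec.dim (vec.span (columns A))"
      by (intro vec.dim_subset) auto
    then show ?thesis by simp
  qed
  have "vec.dim (columns A) \<le> vec.dim (range ((*v) (transpose A)))"
    using dim_rows_le_dim_range[of "transpose A"] by (simp add: rows_transpose)
  also have "\<dots> \<le> vec.dim (rows A)" using range[of "transpose A"] by (simp add: columns_transpose)
  finally show ?thesis
    using range[of A] dim_rows_le_dim_range[of A] by (simp add: row_rank_def_gen)
qed

lemma coordinate_subspace:
  "vec.subspace {z :: 'a::field^'n. \<forall>i\<in>I. z $ i = 0}"
  by (auto simp: vec.subspace_def)

lemma card_le_dim_coordinate_subspace:
  fixes I :: "'n::finite set"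
  shows "card (- I) \<le> vec.dim {z :: 'a::field^'n. \<forall>i\<in>I. z $ i = 0}"
proof -
  let ?B = "(\<lambda>i. axis i 1 :: 'a^'n) ` (- I)"
  have "?B \<subseteq> cart_basis" by (auto simp: cart_basis_def)
  then have "vec.independent ?B" using independent_cart_basis vec.independent_mono by blast
  moreover have "?B \<subseteq> {z. \<forall>i\<in>I. z $ i = 0}" by (auto simp: axis_def)
  ultimately have "card ?B \<le> vec.dim {z :: 'a^'n. \<forall>i\<in>I. z $ i = 0}"
    by (intro vec.independent_card_le_dim)
  moreover have "card ?B = card (- I)"
    by (intro card_image) (auto simp: inj_on_def axis_eq_axis)
  ultimately show ?thesis by simp
qed

lemma subspace_of_dim_containing:
  fixes X :: "('a::field^'n) set"
  assumes X: "vec.subspace X" and a: "a \<in> X" "a \<noteq> 0" and r: "1 \<le> r" "r \<le> vec.dim X"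
  obtains Y where "vec.subspace Y" "a \<in> Y" "Y \<subseteq> X" "vec.dim Y = r"
proof -
  have "vec.independent {a}" using a by simp
  then obtain B where B: "{a} \<subseteq> B" "B \<subseteq> X" "vec.independent B" "X \<subseteq> vec.span B"
    using a vec.maximal_independent_subset_extend[of "{a}" X] by auto
  have "card B = vec.dim X" using B by (simp add: vec.basis_card_eq_dim)
  moreover have "finite B" using B by (simp add: vec.finiteI_independent)
  ultimately obtain C where C: "{a} \<subseteq> C" "C \<subseteq> B" "card C = r"
    using exists_subset_between[of "{a}" r B] B(1) r by auto
  show ?thesis
  proof
    show "vec.dim (vec.span C) = r"
      using C B vec.independent_mono[of B C] by (simp add: vec.dim_eq_card_independent)
    show "vec.span C \<subseteq> X" using C B X by (meson vec.span_minimal order_trans)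
  qed (use C vec.span_base in auto)
qed

section \<open>The Hermitian form\<close>

text \<open>The sesquilinear form polarizing \<open>H_form\<close>, conjugate-linear in its first
  argument. The signs of \<open>H_mat\<close> are written out so that the positive and the negative
  coordinates form separate sums.\<close>

definition H_sesq :: "complex^('p::finite + 'q::finite) \<Rightarrow> complex^('p + 'q) \<Rightarrow> complex" where
  "H_sesq x y = (\<Sum>i\<in>UNIV. cnj (x $ Inl i) * y $ Inl i) - (\<Sum>j\<in>UNIV. cnj (x $ Inr j) * y $ Inr j)"

lemma H_mat_mult:
  "(H_mat *v z) $ Inl i = z $ Inl i" "(H_mat *v z) $ Inr j = - z $ Inr j"
  by (simp_all add: H_mat_def matrix_vector_mult_def if_distrib[of "\<lambda>x. x * _"] cong: if_cong)

lemma sum_UNIV_Plus: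
  fixes g :: "'p::finite + 'q::finite \<Rightarrow> 'c::comm_monoid_add"
  shows "sum g UNIV = (\<Sum>i\<in>UNIV. g (Inl i)) + (\<Sum>j\<in>UNIV. g (Inr j))"
  by (metis UNIV_Plus_UNIV comp_apply finite sum.Plus sum.cong)

lemma cnj_mult_self: "cnj c * c = of_real ((cmod c)\<^sup>2)"
  by (metis complex_norm_square mult.commute)

lemma H_form_sesq: "H_form z = Re (H_sesq z z)"
  by (simp add: H_form_def H_sesq_def sum_UNIV_Plus H_mat_mult sum_negf)

lemma H_form_eq:
  "H_form z = (\<Sum>i\<in>UNIV. (cmod (z $ Inl i))\<^sup>2) - (\<Sum>j\<in>UNIV. (cmod (z $ Inr j))\<^sup>2)"
  by (simp add: H_form_sesq H_sesq_def cnj_mult_self del: of_real_power times_complex.sel)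

lemma H_sesq_cnj: "cnj (H_sesq x y) = H_sesq y x"
  by (simp add: H_sesq_def mult.commute)

lemma H_sesq_add: "H_sesq x (y + z) = H_sesq x y + H_sesq x z"
  by (simp add: H_sesq_def algebra_simps sum.distrib)

lemma H_sesq_scale: "H_sesq x (c *s y) = c * H_sesq x y"
  by (simp add: H_sesq_def algebra_simps sum_distrib_left)

lemma H_form_add: "H_form (x + y) = H_form x + H_form y + 2 * Re (H_sesq y x)"
proof -
  have "H_sesq (x + y) (x + y) = H_sesq x x + H_sesq y y + H_sesq y x + cnj (H_sesq y x)"
    by (metis (no_types, lifting) H_sesq_add H_sesq_cnj add.commute add.left_commute complex_cnj_add)
  then show ?thesis by (simp add: H_form_sesq)
qed

lemma H_form_scale: "H_form (c *s x) = (cmod c)\<^sup>2 * H_form x"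
  by (simp add: H_form_eq norm_mult power_mult_distrib sum_distrib_left right_diff_distrib)

lemma continuous_H_form: "continuous_on S H_form"
  unfolding H_form_eq[abs_def] by (intro continuous_intros)

lemma card_Compl_range:
  "card (- range Inr :: ('p::finite + 'q::finite) set) = CARD('p)"
  "card (- range Inl :: ('p::finite + 'q::finite) set) = CARD('q)"
proof -
  have "x \<in> - range Inr \<longleftrightarrow> x \<in> range Inl" "x \<in> - range Inl \<longleftrightarrow> x \<in> range Inr" for x :: "'p + 'q"
    by (cases x; auto)+
  then have "- range Inr = (range Inl :: ('p + 'q) set)" "- range Inl = (range Inr :: ('p + 'q) set)"
    by blast+
  then show "card (- range Inr :: ('p + 'q) set) = CARD('p)" "card (- range Inl :: ('p + 'q) set) = CARD('q)"
    by (simp_all add: card_image)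
qed

section \<open>Positive vectors under a linear self map\<close>

text \<open>Split \<open>v\<close> into its positive part \<open>a\<close> and its negative part
  \<open>b\<close>, and choose an \<open>r\<close>-plane \<open>Y\<close> of positive coordinate
  vectors through \<open>a\<close>. The plane is the graph over \<open>Y\<close> of the rank-one map
  that projects orthogonally onto the line of \<open>a\<close> and sends \<open>a\<close> to
  \<open>b\<close>. By Cauchy-Schwarz this map shrinks squared norms at least by the factor
  \<open>K / N\<close> < 1, so its graph is positive definite.\<close>

lemma positive_vector_in_positive_plane:
  fixes v :: "complex^('p::finite + 'q::finite)"
  assumes r: "1 \<le> r" "r \<le> CARD('p)" and v: "H_form v > 0"
  obtains P where "P \<in> typeI_domain r" "v \<in> P"
proof -
  define X where "X = {z :: complex^('p + 'q). \<forall>i\<in>range Inr. z $ i = 0}"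
  have X: "vec.subspace X" unfolding X_def by (rule coordinate_subspace)
  define a b :: "complex^('p + 'q)" where "a = (\<chi> i. case i of Inl k \<Rightarrow> v $ Inl k | Inr _ \<Rightarrow> 0)" and
    "b = (\<chi> i. case i of Inl _ \<Rightarrow> 0 | Inr j \<Rightarrow> v $ Inr j)"
  define N where "N = (\<Sum>i\<in>UNIV. (cmod (v $ Inl i))\<^sup>2)"
  define K where "K = (\<Sum>j\<in>UNIV. (cmod (v $ Inr j))\<^sup>2)"
  have KN: "0 \<le> K" "K < N"
    using v unfolding H_form_eq N_def K_def by (auto intro: sum_nonneg)
  define \<phi> where "\<phi> u = (\<Sum>i\<in>UNIV. cnj (v $ Inl i) * u $ Inl i)" for u :: "complex^('p + 'q)"
  \<comment> \<open>Dividing by \<open>N\<close>, the squared norm of \<open>a\<close>, makes the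
    coefficient of \<open>b\<close> equal to 1 at \<open>u = a\<close>, hence
    \<open>L a = v\<close>.\<close>
  define L where "L u = u + (\<phi> u / of_real N) *s b" for u
 have "r \<le> vec.dim X"
    using r card_le_dim_coordinate_subspace[of "range Inr :: ('p + 'q) set", where 'a = complex]
      card_Compl_range[where 'p = 'p and 'q = 'q]
    by (simp add: X_def)
  moreover have "a \<noteq> 0"
  proof
    assume "a = 0"
    then have "v $ Inl i = 0" for i by (simp add: a_def vec_eq_iff split: sum.splits)
    then show False using KN by (simp add: N_def)
  qed
  moreover have "a \<in> X" by (auto simp: a_def X_def)
  ultimately obtain Y where Y: "vec.subspace Y" "a \<in> Y" "Y \<subseteq> X" "vec.dim Y = r"
    using subspace_of_dim_containing[OF X, of a r] r(1) by blast
  have L_Inl: "L u $ Inl i = u $ Inl i" for u i by (simp add: L_def b_def)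
  have L_Inr: "L u $ Inr j = \<phi> u / N * v $ Inr j" if "u \<in> Y" for u j
    using that Y(3) by (auto simp: L_def b_def X_def)
  have lin: "Vector_Spaces.linear (*s) (*s) L"
    by (simp add: Vector_Spaces.linear_iff vec.vector_space_axioms vec_eq_iff L_def \<phi>_def
        algebra_simps sum.distrib sum_distrib_left add_divide_distrib)
  have zero: "u = 0" if "u \<in> Y" "\<And>i. u $ Inl i = 0" for u
    using that Y(3) by (auto simp: vec_eq_iff X_def split_sum_all subset_iff)
  have inj: "inj_on L Y"
  proof
    fix x y assume xy: "x \<in> Y" "y \<in> Y" "L x = L y"
    then have "x - y \<in> Y" using Y(1) by (simp add: vec.subspace_diff)
    moreover have "(x - y) $ Inl i = 0" for i using L_Inl xy(3) by (metis right_minus_eq vector_minus_component)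
    ultimately show "x = y" using zero by fastforce
  qed
  have dim: "vec.dim (L ` Y) = r"
    using vec.dim_image_eq[OF lin, of Y] inj Y by (simp add: vec.span_eq_iff[THEN iffD2])
  have sub: "vec.subspace (L ` Y)"
    using module_hom.subspace_image[OF _ Y(1)] lin by (metis Vector_Spaces.linear_def module_hom_iff_linear)
  have pos: "H_form (L u) > 0" if u: "u \<in> Y" "u \<noteq> 0" for u
  proof -
    define U where "U = (\<Sum>i\<in>UNIV. (cmod (u $ Inl i))\<^sup>2)"
    have "U \<noteq> 0"
    proof
      assume "U = 0"
      then have "\<forall>i\<in>UNIV. (cmod (u $ Inl i))\<^sup>2 = 0"
        unfolding U_def by (subst (asm) sum_nonneg_eq_0_iff) auto
      then show False using zero u by simp
    qed
    then have U: "U > 0" using sum_nonneg[of UNIV "\<lambda>i. (cmod (u $ Inl i))\<^sup>2"] by (simp add: U_def order_less_le)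
    have "cmod (\<phi> u) \<le> (\<Sum>i\<in>UNIV. cmod (v $ Inl i) * cmod (u $ Inl i))"
      unfolding \<phi>_def by (rule order_trans[OF norm_sum]) (simp add: norm_mult)
    then have "(cmod (\<phi> u))\<^sup>2 \<le> (\<Sum>i\<in>UNIV. cmod (v $ Inl i) * cmod (u $ Inl i))\<^sup>2"
      by (intro power_mono) auto
    also have "\<dots> \<le> N * U" unfolding N_def U_def by (rule Cauchy_Schwarz_ineq_sum)
    finally have \<phi>: "(cmod (\<phi> u))\<^sup>2 \<le> N * U" .
    have "H_form (L u) = U - (cmod (\<phi> u))\<^sup>2 / N\<^sup>2 * K"
      using KN by (simp add: H_form_eq L_Inl L_Inr[OF u(1)] U_def K_def norm_mult norm_divide power_mult_distrib
          power_divide sum_distrib_left)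
    also have "\<dots> \<ge> U - N * U / N\<^sup>2 * K"
      using \<phi> KN by (intro diff_left_mono mult_right_mono divide_right_mono) auto
    moreover have "U - N * U / N\<^sup>2 * K = U * (1 - K / N)"
      using KN by (simp add: power2_eq_square field_simps)
    moreover have "U * (1 - K / N) > 0" using U KN by (intro mult_pos_pos) auto
    ultimately show ?thesis by linarith
  qed
  show ?thesis
  proof
    have "L ` Y \<in> Gr r" using sub dim by (simp add: Gr_def)
    then show "L ` Y \<in> typeI_domain r"
      using pos vec.linear_0[OF lin] by (auto simp: typeI_domain_def H_pos_def_def)
    have "\<phi> a = of_real N"
      unfolding \<phi>_def N_def a_def by (simp add: cnj_mult_self del: of_real_power)
    then have "L a = a + b" using KN by (simp add: L_def)
    also have "\<dots> = v" by (simp add: vec_eq_iff a_def b_def split: sum.splits)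
    finally show "v \<in> L ` Y" using Y(2) by (metis imageI)
  qed
qed

text \<open>A positive plane through \<open>v\<close> has a positive image plane containing
  \<open>M *v v\<close>. This vector is nonzero because the negative semi-definite kernel cannot
  contain the positive \<open>v\<close>.\<close>

lemma linear_self_map_positive:
  fixes M :: "complex^('p::finite + 'q::finite)^('p + 'q)"
  assumes r: "1 \<le> r" "r \<le> CARD('p)" and f: "linear_self_map r f" "induces r M f"
    and v: "H_form v > 0"
  shows "H_form (M *v v) > 0"
proof -
  obtain P where P: "P \<in> typeI_domain r" "v \<in> P"
    using positive_vector_in_positive_plane[OF r v] .
  then have "(*v) M ` P \<in> typeI_domain r"
    using f by (auto simp: linear_self_map_def induces_def)
  moreover have "M *v v \<noteq> 0"
    using f(2) v by (force simp: induces_def H_neg_semidef_def)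
  ultimately show ?thesis using P(2) by (auto simp: typeI_domain_def H_pos_def_def)
qed

text \<open>
  For a null vector \<open>z\<^sub>0\<close> of the kernel, a suitable translate \<open>x + t z\<^sub>0\<close> of any \<open>x\<close> outside the
  hyperplane orthogonal to \<open>z\<^sub>0\<close> is positive and has the same image as \<open>x\<close>. Hence the range is
  positive semi-definite, which bounds its dimension by \<open>p\<close>.
\<close>

lemma rank_eq_if_null_vector_in_kernel:
  fixes M :: "complex^('p::finite + 'q::finite)^('p + 'q)"
  assumes ker: "H_neg_semidef {z. M *v z = 0}"
    and pos: "\<And>v. H_form v > 0 \<Longrightarrow> H_form (M *v v) > 0"
    and z0: "z0 \<noteq> 0" "M *v z0 = 0" "H_form z0 = 0"
  shows "rank M = CARD('p)"
proof (rule antisym)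
  have off: "H_form (M *v x) > 0" if "H_sesq z0 x \<noteq> 0" for x
  proof -
    define c where "c = H_sesq z0 x"
    \<comment> \<open>Since \<open>z0\<close> is null, the form of \<open>x + t *s z0\<close> is
      \<open>H_form x\<close> plus twice the real part of \<open>cnj t * c\<close>. With t = s c and
      this \<open>s\<close>, that real part equals 1 + \<bar>H_form x\<bar>, which outweighs a
      negative \<open>H_form x\<close>.\<close>
    define s where "s = (1 + \<bar>H_form x\<bar>) / (cmod c)\<^sup>2"
    define t where "t = of_real s * c"
    have "H_sesq (t *s z0) x = cnj t * c"
      by (metis H_sesq_cnj H_sesq_scale c_def complex_cnj_mult)
    also have "\<dots> = of_real (s * (cmod c)\<^sup>2)"
      using cnj_mult_self[of c] by (simp add: t_def mult.assoc)
    also have "\<dots> = of_real (1 + \<bar>H_form x\<bar>)" using that by (simp add: s_def c_def)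
    finally have "H_form (x + t *s z0) = H_form x + 2 * (1 + \<bar>H_form x\<bar>)"
      by (simp add: H_form_add H_form_scale z0)
    then have "H_form (x + t *s z0) > 0" using abs_ge_minus_self[of "H_form x"] abs_ge_zero[of "H_form x"]
      by (smt (verit))
    moreover have "M *v (x + t *s z0) = M *v x"
      using z0 by (simp add: matrix_vector_right_distrib vector_scalar_commute)
    ultimately show ?thesis using pos by metis
  qed
  have nonneg: "H_form (M *v x) \<ge> 0" for x
  proof (cases "H_sesq z0 x = 0")
    case True
    \<comment> \<open>On the hyperplane itself a limit is used. The vector \<open>y\<close> is
      transversal to it, as its product with \<open>z0\<close> is the squared Euclidean norm of
      \<open>z0\<close>; so \<open>x + e y\<close> lies off the hyperplane for every e > 0, and e
      tends to 0 from above.\<close>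
    define y where "y = H_mat *v z0"
    have "H_sesq z0 y = of_real ((\<Sum>i\<in>UNIV. (cmod (z0 $ i))\<^sup>2))"
      by (simp add: H_sesq_def y_def H_mat_mult sum_UNIV_Plus sum_negf cnj_mult_self del: of_real_power)
    moreover have "(\<Sum>i\<in>UNIV. (cmod (z0 $ i))\<^sup>2) \<noteq> 0"
      using z0(1) by (subst sum_nonneg_eq_0_iff) (auto simp: vec_eq_iff)
    ultimately have y: "H_sesq z0 y \<noteq> 0" by (simp del: of_real_sum)
    have lim: "((\<lambda>e. H_form (M *v x + of_real e *s (M *v y))) \<longlongrightarrow> H_form (M *v x + of_real 0 *s (M *v y))) (at_right 0)"
      unfolding H_form_eq vector_add_component vector_smult_component by (intro tendsto_intros)
    have "H_form (M *v x + of_real e *s (M *v y)) > 0" if "e > 0" for e :: real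
    proof -
      have "H_sesq z0 (x + of_real e *s y) \<noteq> 0" using y True that by (simp add: H_sesq_add H_sesq_scale)
      from off[OF this] show ?thesis
        by (simp add: matrix_vector_right_distrib vector_scalar_commute)
    qed
    then have "eventually (\<lambda>e. H_form (M *v x + of_real e *s (M *v y)) \<ge> 0) (at_right 0)"
      by (intro eventually_at_rightI[of 0 1]) (auto intro: less_imp_le)
    from tendsto_lowerbound[OF lim this] show ?thesis by simp
  qed (use off in \<open>auto intro: less_imp_le\<close>)
  let ?R = "range ((*v) M)"
  define N where "N = {z :: complex^('p + 'q). \<forall>i\<in>range Inl. z $ i = 0}"
  have R: "vec.subspace ?R" by (simp add: vec.subspace_image)
  have N: "vec.subspace N" unfolding N_def by (rule coordinate_subspace)
  \<comment> \<open>The positive semi-definite range is transversal to the negative definite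
    coordinate space \<open>N\<close> of dimension at least q, which leaves it dimension at most
    p.\<close>
  have "z = 0" if "z \<in> ?R" "z \<in> N" for z
  proof -
    have "H_form z = - (\<Sum>j\<in>UNIV. (cmod (z $ Inr j))\<^sup>2)" using that(2) by (simp add: H_form_eq N_def)
    moreover have "H_form z \<ge> 0" using that(1) nonneg by auto
    moreover have "(\<Sum>j\<in>UNIV. (cmod (z $ Inr j))\<^sup>2) \<ge> 0" by (intro sum_nonneg) auto
    ultimately have "(\<Sum>j\<in>UNIV. (cmod (z $ Inr j))\<^sup>2) = 0" by linarith
    then have "\<forall>j\<in>UNIV. (cmod (z $ Inr j))\<^sup>2 = 0" by (subst (asm) sum_nonneg_eq_0_iff) auto
    then show ?thesis using that(2) by (auto simp: vec_eq_iff N_def split_sum_all)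
  qed
  then have "?R \<inter> N \<subseteq> {0}" by blast
  then have "vec.dim (?R \<inter> N) = 0" by simp
  moreover have "vec.dim {x + y | x y. x \<in> ?R \<and> y \<in> N} \<le> CARD('p) + CARD('q)"
    using vec.dim_subset_UNIV[of "{x + y | x y. x \<in> ?R \<and> y \<in> N}"] by (simp add: vec.dimension_def vec_dim_card card_cart_basis)
  moreover have "CARD('q) \<le> vec.dim N"
  proof -
    show ?thesis
      using card_le_dim_coordinate_subspace[of "range Inl :: ('p + 'q) set", where 'a = complex]
      card_Compl_range[where 'p = 'p and 'q = 'q]
      by (simp add: N_def)
  qed
  ultimately have "vec.dim ?R \<le> CARD('p)" using vec.dim_sums_Int[OF R N] by linarith
  then show "rank M \<le> CARD('p)" by (simp add: vec_rank_dim_range)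
next
  \<comment> \<open>Lower bound: \<open>X\<close> is positive definite of dimension at least p and
    the kernel is negative semi-definite, so \<open>M\<close> is injective on
    \<open>X\<close>.\<close>
  define X where "X = {z :: complex^('p + 'q). \<forall>i\<in>range Inr. z $ i = 0}"
  have X: "vec.subspace X" unfolding X_def by (rule coordinate_subspace)
 have "CARD('p) \<le> vec.dim X"
    using card_le_dim_coordinate_subspace[of "range Inr :: ('p + 'q) set", where 'a = complex]
      card_Compl_range[where 'p = 'p and 'q = 'q]
    by (simp add: X_def)
  moreover have "inj_on ((*v) M) X"
  proof
    fix x y assume xy: "x \<in> X" "y \<in> X" "M *v x = M *v y"
    define z where "z = x - y"
    have z: "z \<in> X" "M *v z = 0"
      using xy X by (simp_all add: z_def vec.subspace_diff matrix_vector_mult_diff_distrib)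
    have "H_form z \<le> 0" using ker z(2) by (simp add: H_neg_semidef_def)
    moreover have "H_form z = (\<Sum>i\<in>UNIV. (cmod (z $ Inl i))\<^sup>2)" using z(1) by (simp add: H_form_eq X_def)
    moreover have "(\<Sum>i\<in>UNIV. (cmod (z $ Inl i))\<^sup>2) \<ge> 0" by (intro sum_nonneg) auto
    ultimately have "(\<Sum>i\<in>UNIV. (cmod (z $ Inl i))\<^sup>2) = 0" by linarith
    then have "\<forall>i\<in>UNIV. (cmod (z $ Inl i))\<^sup>2 = 0" by (subst (asm) sum_nonneg_eq_0_iff) auto
    then have "z = 0" using z(1) by (auto simp: vec_eq_iff X_def split_sum_all)
    then show "x = y" by (simp add: z_def)
  qed
  then have "vec.dim ((*v) M ` X) = vec.dim X"
    using X vec.dim_image_eq[of "(*v) M" X] by (metis matrix_vector_mul_linear_gen vec.span_eq_iff)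
  moreover have "vec.dim ((*v) M ` X) \<le> vec.dim (range ((*v) M))" by (intro vec.dim_subset) auto
  ultimately show "CARD('p) \<le> rank M" by (simp add: vec_rank_dim_range)
qed

section \<open>Complex differentiability of matrix expressions\<close>

text \<open>A vector is the sum of its components embedded along the axes, and each embedding is
  bounded linear. The general component type lets the rule act twice on a matrix, first on rows and
  then on entries.\<close>

lemma has_derivative_vecI:
  fixes f :: "'a::real_normed_vector \<Rightarrow> 'b::real_normed_vector^'n"
  assumes "\<And>i. ((\<lambda>x. f x $ i) has_derivative (\<lambda>h. D h $ i)) F"
  shows "(f has_derivative D) F"
proof -
  have axis: "bounded_linear (axis i :: 'b \<Rightarrow> 'b^'n)" for i
  proof (rule bounded_linear_intro[where K = 1])
    show "norm (axis i x :: 'b^'n) \<le> norm x * 1" for x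
    proof -
      have "norm (axis i x :: 'b^'n) \<le> (\<Sum>j\<in>UNIV. norm ((axis i x :: 'b^'n) $ j))"
        unfolding norm_vec_def by (rule L2_set_le_sum) simp
      also have "\<dots> = (\<Sum>j\<in>UNIV. if i = j then norm x else 0)"
        by (intro sum.cong) (auto simp: axis_def)
      finally show ?thesis by simp
    qed
  qed (auto simp: axis_def vec_eq_iff)
  have expand: "(\<Sum>i\<in>UNIV. axis i (x $ i)) = x" for x :: "'b^'n"
    by (simp add: vec_eq_iff axis_def sum_component)
  have "((\<lambda>x. \<Sum>i\<in>UNIV. axis i (f x $ i)) has_derivative (\<lambda>h. \<Sum>i\<in>UNIV. axis i (D h $ i))) F"
    by (intro has_derivative_sum bounded_linear.has_derivative[OF axis] assms)
  then show ?thesis by (simp only: expand)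
qed

text \<open>The condition of \<open>mat_holomorphic_on\<close> for a single entry. Real linearity of
  \<open>D\<close> is part of \<open>has_derivative\<close>, so homogeneity under complex scalars
  makes \<open>D\<close> complex linear.\<close>

definition complex_differentiable ::
    "(complex^'m^'n \<Rightarrow> complex) \<Rightarrow> (complex^'m^'n) filter \<Rightarrow> bool" where
  "complex_differentiable f F \<longleftrightarrow> (\<exists>D. (f has_derivative D) F \<and>
     (\<forall>c X. D (map_matrix ((*) c) X) = c * D X))"

named_theorems cdiff_intros

lemma complex_differentiable_const [cdiff_intros]: "complex_differentiable (\<lambda>_. c) F"
  unfolding complex_differentiable_def by (intro exI[of _ "\<lambda>_. 0"]) auto

lemma complex_differentiable_entry [cdiff_intros]: "complex_differentiable (\<lambda>T. T $ i $ j) F"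
  unfolding complex_differentiable_def
  by (intro exI[of _ "\<lambda>h. h $ i $ j"] conjI bounded_linear.has_derivative[OF bounded_linear_vec_nth]
      has_derivative_ident) auto

lemma complex_differentiable_add [cdiff_intros]:
  assumes "complex_differentiable f F" "complex_differentiable g F"
  shows "complex_differentiable (\<lambda>T. f T + g T) F"
proof -
  from assms obtain D E where "(f has_derivative D) F" "(g has_derivative E) F"
    "\<And>c X. D (map_matrix ((*) c) X) = c * D X" "\<And>c X. E (map_matrix ((*) c) X) = c * E X"
    by (auto simp: complex_differentiable_def)
  then show ?thesis unfolding complex_differentiable_def
    by (intro exI[of _ "\<lambda>h. D h + E h"]) (auto intro: has_derivative_add simp: algebra_simps)
qed

lemma complex_differentiable_mult [cdiff_intros]:
  assumes "complex_differentiable f (at T within S)" "complex_differentiable g (at T within S)"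
  shows "complex_differentiable (\<lambda>T. f T * g T) (at T within S)"
proof -
  from assms obtain D E where "(f has_derivative D) (at T within S)" "(g has_derivative E) (at T within S)"
    "\<And>c X. D (map_matrix ((*) c) X) = c * D X" "\<And>c X. E (map_matrix ((*) c) X) = c * E X"
    by (auto simp: complex_differentiable_def)
  then show ?thesis unfolding complex_differentiable_def
    by (intro exI[of _ "\<lambda>h. f T * E h + D h * g T"] conjI has_derivative_mult) (auto simp: algebra_simps)
qed

lemma complex_differentiable_divide [cdiff_intros]:
  assumes "complex_differentiable f (at T within S)" "complex_differentiable g (at T within S)"
    and "g T \<noteq> 0"
  shows "complex_differentiable (\<lambda>T. f T / g T) (at T within S)"
proof -
  from assms obtain D E where D: "(f has_derivative D) (at T within S)" "(g has_derivative E) (at T within S)"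
    "\<And>c X. D (map_matrix ((*) c) X) = c * D X" "\<And>c X. E (map_matrix ((*) c) X) = c * E X"
    by (auto simp: complex_differentiable_def)
  show ?thesis unfolding complex_differentiable_def
    by (intro exI[of _ "\<lambda>h. (D h * g T - f T * E h) / (g T * g T)"] conjI
        has_derivative_divide'[OF D(1,2) assms(3)]) (auto simp: D algebra_simps)
qed

lemma complex_differentiable_sum [cdiff_intros]:
  "(\<And>i. i \<in> I \<Longrightarrow> complex_differentiable (f i) F) \<Longrightarrow> complex_differentiable (\<lambda>T. \<Sum>i\<in>I. f i T) F"
  by (induction I rule: infinite_finite_induct) (auto intro: cdiff_intros)

lemma complex_differentiable_prod [cdiff_intros]:
  "(\<And>i. i \<in> I \<Longrightarrow> complex_differentiable (f i) (at T within S)) \<Longrightarrow>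
    complex_differentiable (\<lambda>T. \<Prod>i\<in>I. f i T) (at T within S)"
  by (induction I rule: infinite_finite_induct) (auto intro: cdiff_intros)

lemma complex_differentiable_det [cdiff_intros]:
  assumes "\<And>i j. complex_differentiable (\<lambda>T. B T $ i $ j) (at T within S)"
  shows "complex_differentiable (\<lambda>T. det (B T)) (at T within S)"
  unfolding det_def by (intro cdiff_intros assms)

lemma complex_differentiable_matrix_mult [cdiff_intros]:
  assumes "\<And>i j. complex_differentiable (\<lambda>T. A T $ i $ j) (at T within S)"
    and "\<And>i j. complex_differentiable (\<lambda>T. B T $ i $ j) (at T within S)"
  shows "complex_differentiable (\<lambda>T. (A T ** B T) $ i $ j) (at T within S)"
  unfolding matrix_matrix_mult_def by (simp, intro cdiff_intros assms)

lemma complex_differentiable_matrix_add [cdiff_intros]: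
  assumes "complex_differentiable (\<lambda>T. A T $ i $ j) F" "complex_differentiable (\<lambda>T. B T $ i $ j) F"
  shows "complex_differentiable (\<lambda>T. (A T + B T) $ i $ j) F"
  unfolding vector_add_component by (intro cdiff_intros assms)

lemma complex_differentiable_imp_continuous_on:
  assumes "\<And>T. T \<in> S \<Longrightarrow> complex_differentiable f (at T within S)"
  shows "continuous_on S f"
  unfolding continuous_on_eq_continuous_within
  using assms complex_differentiable_def has_derivative_continuous by blast

section \<open>Inverse matrices with rational entries\<close>

text \<open>The adjugate divided by the determinant: column \<open>l\<close> is Cramer's solution of
  \<open>B *v x = axis l 1\<close>. As explicit quotients of determinants, the entries are visibly
  rational in those of \<open>B\<close>, so the differentiation rules apply to them.\<close>

definition cramer_inverse :: "'a::field^'n^'n \<Rightarrow> 'a^'n^'n" where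
  "cramer_inverse B = (\<chi> k l. det (\<chi> i j. if j = k then axis l 1 $ i else B $ i $ j) / det B)"

lemma cramer_inverse:
  fixes B :: "'a::field^'n^'n"
  assumes "det B \<noteq> 0"
  shows "B ** cramer_inverse B = mat 1" "cramer_inverse B ** B = mat 1"
proof -
  have col: "column l (cramer_inverse B) = (\<chi> k. det (\<chi> i j. if j = k then axis l 1 $ i else B $ i $ j) / det B)" for l
    by (simp add: column_def cramer_inverse_def)
  have "column l (B ** cramer_inverse B) = axis l 1" for l
  proof -
    have "column l (B ** cramer_inverse B) = B *v (cramer_inverse B *v axis l 1)"
      by (simp add: matrix_vector_mult_axis[symmetric] matrix_vector_mul_assoc)
    also have "\<dots> = B *v column l (cramer_inverse B)" by (simp add: matrix_vector_mult_axis)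
    also have "\<dots> = axis l 1" unfolding col by (subst cramer[OF assms]) simp
    finally show ?thesis .
  qed
  then have "(B ** cramer_inverse B) $ k $ l = mat 1 $ k $ l" for k l
    by (simp add: column_def vec_eq_iff axis_def mat_def)
  then show "B ** cramer_inverse B = mat 1" by (simp add: vec_eq_iff)
  then show "cramer_inverse B ** B = mat 1" by (simp add: matrix_left_right_inverse)
qed

lemma complex_differentiable_cramer_inverse [cdiff_intros]:
  assumes B: "\<And>i j. complex_differentiable (\<lambda>T. B T $ i $ j) (at T within S)" and "det (B T) \<noteq> 0"
  shows "complex_differentiable (\<lambda>T. cramer_inverse (B T) $ k $ l) (at T within S)"
proof -
  have "complex_differentiable (\<lambda>T. if j = k then axis l 1 $ i else B T $ i $ j) (at T within S)" for i j
    using B by (cases "j = k") (simp_all add: complex_differentiable_const)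
  then show ?thesis
    unfolding cramer_inverse_def vec_lambda_beta
    by (intro complex_differentiable_divide complex_differentiable_det) (simp_all only: vec_lambda_beta assms not_False_eq_True)
qed

lemma mat_holomorphic_onI:
  fixes f :: "complex^'n^'n \<Rightarrow> complex^'n^'n"
  assumes "\<And>T i j. T \<in> S \<Longrightarrow> complex_differentiable (\<lambda>T. f T $ i $ j) (at T within S)"
  shows "mat_holomorphic_on f S"
  unfolding mat_holomorphic_on_def
proof
  fix T assume "T \<in> S"
  then have "\<forall>i j. \<exists>D. ((\<lambda>T. f T $ i $ j) has_derivative D) (at T within S) \<and>
     (\<forall>c X. D (map_matrix ((*) c) X) = c * D X)"
    using assms unfolding complex_differentiable_def by blast
  then obtain D where D: "\<And>i j. ((\<lambda>T. f T $ i $ j) has_derivative D i j) (at T within S)"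
    "\<And>i j c X. D i j (map_matrix ((*) c) X) = c * D i j X" by metis
  show "\<exists>D. (f has_derivative D) (at T within S) \<and>
     (\<forall>c X. D (map_matrix ((*) c) X) = map_matrix ((*) c) (D X))"
  proof (intro exI[of _ "\<lambda>h. \<chi> i j. D i j h"] conjI allI)
    show "(f has_derivative (\<lambda>h. \<chi> i j. D i j h)) (at T within S)"
      by (intro has_derivative_vecI) (simp add: D(1))
  qed (simp add: vec_eq_iff D(2))
qed

lemma mat_holomorphic_on_cong:
  assumes "\<And>T. T \<in> S \<Longrightarrow> f T = g T" "mat_holomorphic_on g S"
  shows "mat_holomorphic_on f S"
  unfolding mat_holomorphic_on_def
proof
  fix T assume T: "T \<in> S"
  then obtain D where D: "(g has_derivative D) (at T within S)"
    "\<forall>c X. D (map_matrix ((*) c) X) = map_matrix ((*) c) (D X)"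
    using assms(2) by (auto simp: mat_holomorphic_on_def)
  have "(f has_derivative D) (at T within S)"
    using T assms(1) D(1) by (rule has_derivative_transform)
  then show "\<exists>D. (f has_derivative D) (at T within S) \<and>
     (\<forall>c X. D (map_matrix ((*) c) X) = map_matrix ((*) c) (D X))"
    using D(2) by blast
qed

lemma mat_holomorphic_on_imp_continuous_on:
  "mat_holomorphic_on f S \<Longrightarrow> continuous_on S f"
  unfolding mat_holomorphic_on_def continuous_on_eq_continuous_within
  by (meson has_derivative_continuous)

section \<open>Linear maps between charts\<close>

text \<open>The planes that \<open>M\<close> maps injectively, that is, those whose image is again
  an \<open>r\<close>-plane. This set serves as the neighborhood to which the map extends.\<close>

definition kernel_free :: "nat \<Rightarrow> complex^'n^'n \<Rightarrow> (complex^'n) set set" where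
  "kernel_free r M = {P \<in> Gr r. \<forall>z\<in>P. M *v z = 0 \<longrightarrow> z = 0}"

lemma image_in_Gr:
  assumes "P \<in> kernel_free r M"
  shows "(*v) M ` P \<in> Gr r"
proof -
  have P: "vec.subspace P" "vec.dim P = r" and ker: "\<And>z. z \<in> P \<Longrightarrow> M *v z = 0 \<Longrightarrow> z = 0"
    using assms by (auto simp: kernel_free_def Gr_def)
  have "inj_on ((*v) M) P"
  proof
    fix x y assume xy: "x \<in> P" "y \<in> P" "M *v x = M *v y"
    have "x - y = 0"
    proof (rule ker)
      show "x - y \<in> P" using P(1) xy by (simp add: vec.subspace_diff)
      show "M *v (x - y) = 0" using xy by (simp add: matrix_vector_mult_diff_distrib)
    qed
    then show "x = y" by simp
  qed
  then have "vec.dim ((*v) M ` P) = r"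
    using P vec.dim_image_eq[of "(*v) M" P] by (metis matrix_vector_mul_linear_gen vec.span_eq_iff)
  then show ?thesis using P(1) by (simp add: Gr_def vec.subspace_image)
qed

text \<open>The kernel of a linear projection onto \<open>P\<close> is a complement of
  \<open>P\<close>. This allows a chart to be centred at any prescribed plane.\<close>

lemma splitting_exists:
  assumes "P \<in> Gr r"
  obtains W where "(P, W) \<in> splittings r"
proof -
  have P: "vec.subspace P" using assms by (simp add: Gr_def)
  have "\<exists>g. g ` UNIV \<subseteq> P \<and> Vector_Spaces.linear (*s) (*s) g \<and> (\<forall>v\<in>P. g (id v) = v)"
    by (rule vec.linear_exists_left_inverse_on[OF vec.linear_id P]) simp
  then obtain g where g: "\<And>z. g z \<in> P" "Vector_Spaces.linear (*s) (*s) g" "\<And>v. v \<in> P \<Longrightarrow> g v = v"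
    by auto
  define W where "W = {z. g z = 0}"
  have W: "vec.subspace W"
    unfolding W_def using g(2) by (auto simp: vec.subspace_def Vector_Spaces.linear_iff vec.linear_0)
  have "z \<in> {v + w | v w. v \<in> P \<and> w \<in> W}" for z
  proof -
    have "g (z - g z) = 0" using g vec.linear_diff[OF g(2)] by simp
    then have "z = g z + (z - g z) \<and> g z \<in> P \<and> z - g z \<in> W" using g(1) by (simp add: W_def)
    then show ?thesis by blast
  qed
  then have "(P, W) \<in> splittings r"
    using assms P W g(3) by (auto simp: splittings_def W_def vec.subspace_0)
  then show ?thesis using that by blast
qed

lemma graph_in_Gr:
  assumes "(V, W) \<in> splittings r" "T \<in> hom_space W"
  shows "graph V T \<in> Gr r"
  using bij_betw_apply[OF graph_bij_betw[OF assms(1)] assms(2)] by (auto simp: chart_domain_def)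

lemma graph_vector_eq_0_iff:
  assumes "(V, W) \<in> splittings r" "T \<in> hom_space W" "v \<in> V"
  shows "v + T *v v = 0 \<longleftrightarrow> v = 0"
proof
  assume "v + T *v v = 0"
  then have "v = - (T *v v)" by (simp add: eq_neg_iff_add_eq_0)
  moreover have "T *v v \<in> W" "vec.subspace W" "V \<inter> W = {0}"
    using assms by (auto simp: hom_space_def splittings_def)
  ultimately show "v = 0" using assms(3) by (metis IntI singletonD vec.subspace_neg)
qed simp

text \<open>
  With \<open>A\<close> the projection onto \<open>V'\<close> along \<open>W'\<close>, \<open>J\<close> an isomorphism \<open>V' \<rightarrow> V\<close> and \<open>N = M (1 + T)\<close>,
  the matrix \<open>B T\<close> is \<open>A N J\<close> on \<open>V'\<close> and the identity on \<open>W'\<close>. The image plane \<open>N V\<close> is then the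
  range of \<open>N J B\<^sup>-\<^sup>1\<close> on \<open>V'\<close>, whose \<open>V'\<close>-component is the identity.
\<close>

lemma linear_image_in_charts:
  fixes M :: "complex^'n^'n"
  assumes VW: "(V, W) \<in> splittings r" and VW': "(V', W') \<in> splittings r"
  obtains B G :: "complex^'n^'n \<Rightarrow> complex^'n^'n" where
    "\<And>T. T \<in> hom_space W \<Longrightarrow> det (B T) \<noteq> 0 \<longleftrightarrow>
       graph V T \<in> kernel_free r M \<and> (*v) M ` graph V T \<in> chart_domain r W'"
    "\<And>T. T \<in> hom_space W \<Longrightarrow> det (B T) \<noteq> 0 \<Longrightarrow> G T \<in> hom_space W'"
    "\<And>T. T \<in> hom_space W \<Longrightarrow> det (B T) \<noteq> 0 \<Longrightarrow> graph V' (G T) = (*v) M ` graph V T"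
    "\<And>T S i j. complex_differentiable (\<lambda>T. B T $ i $ j) (at T within S)"
    "\<And>T S i j. det (B T) \<noteq> 0 \<Longrightarrow> complex_differentiable (\<lambda>T. G T $ i $ j) (at T within S)"
proof -
  have V: "vec.subspace V" "vec.dim V = r" using VW by (auto simp: splittings_def Gr_def)
  have V': "vec.subspace V'" "vec.dim V' = r" and W': "vec.subspace W'" and 0: "V' \<inter> W' = {0}"
    and sum: "{v + w | v w. v \<in> V' \<and> w \<in> W'} = UNIV"
    using VW' by (auto simp: splittings_def Gr_def)
  obtain A :: "complex^'n^'n" where A: "\<And>z. A *v z \<in> V'" "\<And>z. z - A *v z \<in> W'"
    "\<And>v. v \<in> V' \<Longrightarrow> A *v v = v" "\<And>w. w \<in> W' \<Longrightarrow> A *v w = 0"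
    using projection_matrix_exists[OF V'(1) W' 0 sum] by blast
  have W'_iff: "z \<in> W' \<longleftrightarrow> A *v z = 0" for z using A(2)[of z] A(4)[of z] by auto
  obtain j where j: "Vector_Spaces.linear (*s) (*s) j" "j ` V' = V" "inj_on j V'"
    using vec.subspace_isomorphism[OF V'(1) V(1)] V V' by auto
  define J where "J = matrix j"
  have J: "J *v z = j z" for z using j(1) by (simp add: J_def matrix_works)
  have J_image: "(*v) J ` V' = V" using j(2) J by simp
  have J_0: "z = 0" if "z \<in> V'" "J *v z = 0" for z
    using that j(3) V'(1) vec.linear_0[OF j(1)] J by (metis inj_onD vec.subspace_0)
  define N where "N T = M ** (mat 1 + T)" for T
  \<comment> \<open>Differences are written as sums with \<open>- A\<close>, the form to which the
    rules in \<open>cdiff_intros\<close> apply.\<close>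
  define B where "B T = A ** (N T ** (J ** A)) + (mat 1 + - A)" for T
  define G where "G T = N T ** (J ** (cramer_inverse (B T) ** A)) + - A" for T
  have N: "N T *v z = M *v (z + T *v z)" for T z
    by (simp add: N_def matrix_vector_mul_assoc[symmetric] matrix_vector_mult_add_rdistrib)
  have B: "B T *v z = A *v (N T *v (J *v (A *v z))) + (z - A *v z)" for T z
    by (simp add: B_def matrix_vector_mul_assoc[symmetric] matrix_vector_mult_add_rdistrib
        matrix_vector_mult_diff_rdistrib)
  have G: "G T *v z = N T *v (J *v (cramer_inverse (B T) *v (A *v z))) - A *v z" for T z
    by (simp add: G_def matrix_vector_mul_assoc[symmetric] matrix_vector_mult_add_rdistrib
        matrix_vector_mult_diff_rdistrib)
  have image: "(*v) M ` graph V T = (*v) (N T) ` V" for T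
    by (simp add: graph_def image_image N)
  have AB: "A *v (B T *v z) = A *v (N T *v (J *v (A *v z)))" for T z
    unfolding B by (simp add: matrix_vector_right_distrib A(1,3) A(4)[OF A(2)])
  have B_V': "B T *v v = A *v (N T *v (J *v v))" if "v \<in> V'" for T v
    using that by (simp add: B A(3))
  \<comment> \<open>\<open>B T\<close> leaves the \<open>W'\<close>-component of every vector
    unchanged, so only vectors of \<open>V'\<close> can be mapped into \<open>V'\<close>. Hence the
    inverse of \<open>B T\<close> preserves \<open>V'\<close> too.\<close>
  have B_mem: "z \<in> V'" if "B T *v z \<in> V'" for T z
  proof -
    have "B T *v z = A *v (N T *v (J *v (A *v z)))" using AB A(3)[OF that] by simp
    then have "z - A *v z = 0" using B[of T z] by simp
    then show ?thesis using A(1)[of z] by simp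
  qed
  \<comment> \<open>Only the block on \<open>V'\<close> can be singular, and it kills a vector
    exactly when \<open>N T\<close> sends the corresponding vector of \<open>V\<close> into
    \<open>W'\<close>. One determinant thus detects both a kernel vector in the plane and a failure
    of transversality of the image to \<open>W'\<close>.\<close>
  have det_iff: "det (B T) \<noteq> 0 \<longleftrightarrow> (\<forall>v\<in>V. N T *v v \<in> W' \<longrightarrow> v = 0)" for T
  proof -
    have "det (B T) \<noteq> 0 \<longleftrightarrow> (\<forall>z. B T *v z = 0 \<longrightarrow> z = 0)"
      by (metis invertible_det_nz invertible_left_inverse matrix_left_invertible_ker)
    also have "\<dots> \<longleftrightarrow> (\<forall>z\<in>V'. B T *v z = 0 \<longrightarrow> z = 0)"
      using B_mem V'(1) by (metis vec.subspace_0)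
    also have "\<dots> \<longleftrightarrow> (\<forall>z\<in>V'. N T *v (J *v z) \<in> W' \<longrightarrow> J *v z = 0)"
      using J_0 by (auto simp: B_V' W'_iff)
    also have "\<dots> \<longleftrightarrow> (\<forall>v\<in>V. N T *v v \<in> W' \<longrightarrow> v = 0)"
      unfolding J_image[symmetric] by simp
    finally show ?thesis .
  qed
  show ?thesis
  proof (rule that[of B G])
    fix T assume T: "T \<in> hom_space W"
    have g0: "v + T *v v = 0 \<longleftrightarrow> v = 0" if "v \<in> V" for v
      using graph_vector_eq_0_iff[OF VW T that] .
    have kernel: "graph V T \<in> kernel_free r M \<longleftrightarrow> (\<forall>v\<in>V. N T *v v = 0 \<longrightarrow> v = 0)"
      using graph_in_Gr[OF VW T] g0 by (auto simp: kernel_free_def graph_def N)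
    show "det (B T) \<noteq> 0 \<longleftrightarrow>
       graph V T \<in> kernel_free r M \<and> (*v) M ` graph V T \<in> chart_domain r W'"
    proof
      assume "det (B T) \<noteq> 0"
      then have *: "\<And>v. v \<in> V \<Longrightarrow> N T *v v \<in> W' \<Longrightarrow> v = 0" by (simp add: det_iff)
      then have free: "graph V T \<in> kernel_free r M"
        unfolding kernel using W' by (metis vec.subspace_0)
      moreover have "(*v) (N T) ` V \<inter> W' = {0}"
      proof -
        have "N T *v v = 0" if "v \<in> V" "N T *v v \<in> W'" for v using *[OF that] by simp
        moreover have "0 \<in> (*v) (N T) ` V"
          using V(1) by (intro image_eqI[of _ _ 0]) (simp_all add: vec.subspace_0)
        ultimately show ?thesis using W' vec.subspace_0 by blast
      qed
      ultimately show "graph V T \<in> kernel_free r M \<and> (*v) M ` graph V T \<in> chart_domain r W'"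
        using image_in_Gr[OF free] by (simp add: chart_domain_def image)
    next
      assume *: "graph V T \<in> kernel_free r M \<and> (*v) M ` graph V T \<in> chart_domain r W'"
      then have "(*v) (N T) ` V \<inter> W' = {0}" by (simp add: chart_domain_def image)
      then show "det (B T) \<noteq> 0" using * unfolding det_iff kernel by blast
    qed
    assume det: "det (B T) \<noteq> 0"
    define C where "C = cramer_inverse (B T)"
    have BC: "B T *v (C *v z) = z" and CB: "C *v (B T *v z) = z" for z
      using cramer_inverse[OF det] by (simp_all add: C_def matrix_vector_mul_assoc)
    have C_V': "C *v v \<in> V'" if "v \<in> V'" for v using B_mem[of T "C *v v"] that by (simp add: BC)
    have G_mem: "G T *v z \<in> W'" for z
    proof -
      have "A *v (N T *v (J *v (C *v (A *v z)))) = A *v z"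
        using B_V'[OF C_V'[OF A(1)], of T z] by (simp add: BC)
      then show ?thesis by (simp add: W'_iff G C_def matrix_vector_mult_diff_distrib A(1,3))
    qed
    have "G T *v w = 0" if "w \<in> W'" for w by (simp add: G A(4)[OF that])
    with G_mem show "G T \<in> hom_space W'" by (simp add: hom_space_def)
    have C_image: "(*v) C ` V' = V'"
    proof
      show "(*v) C ` V' \<subseteq> V'" using C_V' by blast
      show "V' \<subseteq> (*v) C ` V'"
      proof
        fix v assume "v \<in> V'"
        then have "B T *v v \<in> V'" using B_V' A(1) by simp
        then show "v \<in> (*v) C ` V'" using CB by (metis imageI)
      qed
    qed
    have "graph V' (G T) = (\<lambda>v. N T *v (J *v (C *v v))) ` V'"
      unfolding graph_def by (intro image_cong) (simp_all add: G A(3) C_def)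
    also have "\<dots> = (*v) (N T) ` (*v) J ` (*v) C ` V'" by (simp only: image_image)
    finally show "graph V' (G T) = (*v) M ` graph V T" by (simp only: C_image J_image image)
  next
    fix T S i k
    show B_diff: "complex_differentiable (\<lambda>T. B T $ i $ k) (at T within S)" for i k
      unfolding B_def N_def by (intro cdiff_intros)
    show "complex_differentiable (\<lambda>T. G T $ i $ k) (at T within S)" if "det (B T) \<noteq> 0"
      unfolding G_def N_def by (intro cdiff_intros B_diff that)
  qed
qed

section \<open>Openness and holomorphy of the induced map\<close>

text \<open>Serves both for the openness of \<open>kernel_free r M\<close> and for the continuity of
  the induced map. Near each point the set contains the preimage of an open set under the chart
  expression \<open>G\<close>, which is continuous where the determinant of \<open>B\<close> does
  not vanish.\<close>

lemma openin_kernel_free_preimage: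
  fixes M :: "complex^'n^'n"
  assumes Y: "openin (Gr_topology r) Y"
  shows "openin (Gr_topology r) {P \<in> kernel_free r M. (*v) M ` P \<in> Y}"
  unfolding openin_Gr_topology
proof (intro conjI ballI, simp_all only: split_paired_all prod.case)
  show "{P \<in> kernel_free r M. (*v) M ` P \<in> Y} \<subseteq> Gr r" by (auto simp: kernel_free_def)
  fix V W :: "(complex^'n) set" assume VW: "(V, W) \<in> splittings r"
  let ?h = "top_of_set (hom_space W)"
  let ?S = "{T \<in> hom_space W. graph V T \<in> {P \<in> kernel_free r M. (*v) M ` P \<in> Y}}"
  have "\<exists>X. openin ?h X \<and> T0 \<in> X \<and> X \<subseteq> ?S" if T0: "T0 \<in> ?S" for T0
  proof -
    \<comment> \<open>Centring the target chart at the image plane itself guarantees that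
      \<open>T0\<close> lies in the set where the determinant is nonzero.\<close>
    define V' where "V' = (*v) M ` graph V T0"
    have V': "V' \<in> Gr r" using T0 image_in_Gr unfolding V'_def by blast
    then obtain W' where VW': "(V', W') \<in> splittings r" by (rule splitting_exists)
    obtain B G :: "complex^'n^'n \<Rightarrow> complex^'n^'n" where BG: "\<And>T. T \<in> hom_space W \<Longrightarrow> det (B T) \<noteq> 0 \<longleftrightarrow>
         graph V T \<in> kernel_free r M \<and> (*v) M ` graph V T \<in> chart_domain r W'"
      "\<And>T. T \<in> hom_space W \<Longrightarrow> det (B T) \<noteq> 0 \<Longrightarrow> G T \<in> hom_space W'"
      "\<And>T. T \<in> hom_space W \<Longrightarrow> det (B T) \<noteq> 0 \<Longrightarrow> graph V' (G T) = (*v) M ` graph V T"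
      "\<And>T S i j. complex_differentiable (\<lambda>T. B T $ i $ j) (at T within S)"
      "\<And>T S i j. det (B T) \<noteq> 0 \<Longrightarrow> complex_differentiable (\<lambda>T. G T $ i $ j) (at T within S)"
      by (fact linear_image_in_charts[OF VW VW'])
    define D where "D = {T \<in> hom_space W. det (B T) \<noteq> 0}"
    define Y' where "Y' = {X \<in> hom_space W'. graph V' X \<in> Y}"
    have "continuous_on (hom_space W) (\<lambda>T. det (B T))"
      by (intro complex_differentiable_imp_continuous_on complex_differentiable_det BG(4))
    then have "openin ?h (hom_space W \<inter> (\<lambda>T. det (B T)) -` (- {0}))"
      by (rule continuous_openin_preimage_gen) (simp add: open_Compl)
    then have D: "openin ?h D" by (simp add: D_def vimage_def Collect_conj_eq)
    have "continuous_on D G"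
      by (intro mat_holomorphic_on_imp_continuous_on mat_holomorphic_onI BG(5)) (simp add: D_def)
    moreover have "openin (top_of_set (hom_space W')) Y'"
      using Y VW' by (auto simp: openin_Gr_topology Y'_def)
    moreover have "G \<in> D \<rightarrow> hom_space W'" using BG(2) by (auto simp: D_def)
    ultimately have "openin (top_of_set D) (D \<inter> G -` Y')" by (intro continuous_openin_preimage)
    then have X: "openin ?h (D \<inter> G -` Y')" using D by (rule openin_trans)
    have "V' \<in> chart_domain r W'" using V' VW' by (simp add: chart_domain_def splittings_def)
    then have "T0 \<in> D" using T0 BG(1) by (simp add: D_def V'_def)
    then have "T0 \<in> D \<inter> G -` Y'" using T0 BG(2,3) by (auto simp: D_def Y'_def)
    moreover have "D \<inter> G -` Y' \<subseteq> ?S" using BG(1,3) by (auto simp: D_def Y'_def)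
    ultimately show ?thesis using X by blast
  qed
  then show "openin ?h ?S" by (subst openin_subopen) blast
qed

lemma Gr_holomorphic_on_image:
  fixes M :: "complex^'n^'n"
  shows "Gr_holomorphic_on r (\<lambda>P. (*v) M ` P) (kernel_free r M)"
  unfolding Gr_holomorphic_on_def
proof (intro conjI)
  \<comment> \<open>Taking all of \<open>Gr r\<close> as the open target turns the preimage into
    \<open>kernel_free r M\<close>.\<close>
  have "openin (Gr_topology r) {P \<in> kernel_free r M. (*v) M ` P \<in> Gr r}"
    by (rule openin_kernel_free_preimage) (metis openin_topspace topspace_Gr_topology)
  moreover have "{P \<in> kernel_free r M. (*v) M ` P \<in> Gr r} = kernel_free r M"
    using image_in_Gr by blast
  ultimately show U: "openin (Gr_topology r) (kernel_free r M)" by simp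
  have top: "topspace (subtopology (Gr_topology r) (kernel_free r M)) = kernel_free r M"
    by (auto simp: kernel_free_def)
  show "continuous_map (subtopology (Gr_topology r) (kernel_free r M)) (Gr_topology r) (\<lambda>P. (*v) M ` P)"
    unfolding continuous_map top using image_in_Gr openin_kernel_free_preimage U
    by (auto simp: openin_open_subtopology)
next
  show "\<forall>(V, W)\<in>splittings r. \<forall>(V', W')\<in>splittings r.
      mat_holomorphic_on (\<lambda>T. chart V' W' ((*v) M ` graph V T))
        {T \<in> hom_space W. graph V T \<in> kernel_free r M \<and> (*v) M ` graph V T \<in> chart_domain r W'}"
  proof clarify
    fix V W V' W' :: "(complex^'n) set"
    assume VW: "(V, W) \<in> splittings r" and VW': "(V', W') \<in> splittings r"
    obtain B G :: "complex^'n^'n \<Rightarrow> complex^'n^'n" where BG: "\<And>T. T \<in> hom_space W \<Longrightarrow> det (B T) \<noteq> 0 \<longleftrightarrow>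
         graph V T \<in> kernel_free r M \<and> (*v) M ` graph V T \<in> chart_domain r W'"
      "\<And>T. T \<in> hom_space W \<Longrightarrow> det (B T) \<noteq> 0 \<Longrightarrow> G T \<in> hom_space W'"
      "\<And>T. T \<in> hom_space W \<Longrightarrow> det (B T) \<noteq> 0 \<Longrightarrow> graph V' (G T) = (*v) M ` graph V T"
      "\<And>T S i j. complex_differentiable (\<lambda>T. B T $ i $ j) (at T within S)"
      "\<And>T S i j. det (B T) \<noteq> 0 \<Longrightarrow> complex_differentiable (\<lambda>T. G T $ i $ j) (at T within S)"
      by (fact linear_image_in_charts[OF VW VW'])
    let ?S = "{T \<in> hom_space W. graph V T \<in> kernel_free r M \<and> (*v) M ` graph V T \<in> chart_domain r W'}"
    have det: "T \<in> hom_space W" "det (B T) \<noteq> 0" if "T \<in> ?S" for T using that BG(1) by auto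
    show "mat_holomorphic_on (\<lambda>T. chart V' W' ((*v) M ` graph V T)) ?S"
    proof (rule mat_holomorphic_on_cong)
      show "mat_holomorphic_on G ?S" by (intro mat_holomorphic_onI BG(5) det(2))
      fix T assume T: "T \<in> ?S"
      \<comment> \<open>\<open>G T\<close> is a chart parameter of the image plane; injectivity of
        the parametrization makes it the value of \<open>chart\<close>.\<close>
      have "inj_on (graph V') (hom_space W')" using graph_bij_betw[OF VW'] by (simp add: bij_betw_def)
      from the_inv_into_f_f[OF this BG(2)[OF det[OF T]]]
      show "chart V' W' ((*v) M ` graph V T) = G T"
        by (simp add: chart_def BG(3)[OF det[OF T]])
    qed
  qed
qed

section \<open>The closure of the domain and the extension\<close>

text \<open>If \<open>v + T *v v\<close> is a negative vector, it stays negative for nearby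
  \<open>T\<close> with \<open>v\<close> fixed. So in each chart the complement is a union, over
  \<open>v\<close>, of open sets.\<close>

lemma closedin_positive_semidefinite:
  "closedin (Gr_topology r) {P \<in> Gr r :: (complex^('p::finite + 'q::finite)) set set. \<forall>z\<in>P. H_form z \<ge> 0}"
proof -
  have "openin (Gr_topology r) {P \<in> Gr r :: (complex^('p + 'q)) set set. \<exists>z\<in>P. H_form z < 0}"
    unfolding openin_Gr_topology
  proof (intro conjI ballI, simp_all only: split_paired_all prod.case)
    fix V W :: "(complex^('p + 'q)) set" assume VW: "(V, W) \<in> splittings r"
    let ?h = "top_of_set (hom_space W)"
    have eq: "{T \<in> hom_space W. graph V T \<in> {P \<in> Gr r. \<exists>z\<in>P. H_form z < 0}} =
        (\<Union>v\<in>V. hom_space W \<inter> (\<lambda>T. H_form (v + T *v v)) -` {..<0})"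
      using graph_in_Gr[OF VW] by (auto simp: graph_def)
    have "openin ?h (hom_space W \<inter> (\<lambda>T. H_form (v + T *v v)) -` {..<0})" for v
    proof (rule continuous_openin_preimage_gen)
      show "continuous_on (hom_space W) (\<lambda>T. H_form (v + T *v v))"
        unfolding matrix_vector_mult_def
        by (intro continuous_on_compose2[OF continuous_H_form[of UNIV]] continuous_intros) auto
    qed simp
    then show "openin ?h {T \<in> hom_space W. graph V T \<in> {P \<in> Gr r. \<exists>z\<in>P. H_form z < 0}}"
      unfolding eq by (intro openin_Union) blast
  qed auto
  moreover have "Gr r - {P \<in> Gr r :: (complex^('p + 'q)) set set. \<forall>z\<in>P. H_form z \<ge> 0} = {P \<in> Gr r. \<exists>z\<in>P. H_form z < 0}"
    by (auto simp: not_le)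
  ultimately have "openin (Gr_topology r) (Gr r - {P \<in> Gr r :: (complex^('p + 'q)) set set. \<forall>z\<in>P. H_form z \<ge> 0})"
    by metis
  then show ?thesis unfolding closedin_def topspace_Gr_topology by blast
qed

theorem theorem2p6:
  fixes r :: nat
    and f :: "(complex^('p::finite + 'q::finite)) set \<Rightarrow> (complex^('p + 'q)) set"
  assumes "1 \<le> r" and "r \<le> CARD('p)"
    and "linear_self_map r f" and "\<not> minimal_linear_self_map r f"
  shows "\<exists>U F. openin (Gr_topology r) U \<and>
           typeI_domain r \<union> Gr_topology r frontier_of typeI_domain r \<subseteq> U \<and>
           Gr_holomorphic_on r F U \<and>
           (\<forall>P\<in>typeI_domain r. F P = f P)"
proof -
  obtain M where M: "induces r M f" using assms(3) by (auto simp: linear_self_map_def)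
  have neg: "H_neg_semidef {z. M *v z = 0}" using M by (simp add: induces_def)
  \<comment> \<open>Minimality asks for some inducing matrix of rank p, so its failure excludes rank
    p for the chosen \<open>M\<close>.\<close>
  have "rank M \<noteq> CARD('p)" using assms(3,4) M by (auto simp: minimal_linear_self_map_def)
  then have null: "z = 0" if "M *v z = 0" "H_form z = 0" for z
    using rank_eq_if_null_vector_in_kernel[OF neg] that
      linear_self_map_positive[OF assms(1-3) M] by blast
  \<comment> \<open>A closed set containing the domain already captures its boundary, so the closure
    itself is not computed.\<close>
  let ?Q = "{P \<in> Gr r :: (complex^('p + 'q)) set set. \<forall>z\<in>P. H_form z \<ge> 0}"
  have Q: "?Q \<subseteq> kernel_free r M"
  proof
    fix P assume P: "P \<in> ?Q"
    have "z = 0" if "z \<in> P" "M *v z = 0" for z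
    proof (rule null)
      \<comment> \<open>The plane gives \<ge> 0 and the kernel gives \<le> 0.\<close>
      show "H_form z = 0" using P neg that by (intro antisym) (auto simp: H_neg_semidef_def)
    qed (rule that(2))
    then show "P \<in> kernel_free r M" using P by (simp add: kernel_free_def)
  qed
  have dom: "typeI_domain r \<subseteq> ?Q"
  proof
    fix P :: "(complex^('p + 'q)) set" assume P: "P \<in> typeI_domain r"
    have "H_form z \<ge> 0" if "z \<in> P" for z
      using P that by (cases "z = 0") (auto simp: typeI_domain_def H_pos_def_def H_form_eq less_imp_le)
    then show "P \<in> ?Q" using P by (simp add: typeI_domain_def)
  qed
  have "Gr_topology r frontier_of typeI_domain r \<subseteq> Gr_topology r closure_of typeI_domain r"
    by (auto simp: frontier_of_def)
  also have "\<dots> \<subseteq> ?Q" by (rule closure_of_minimal[OF dom closedin_positive_semidefinite])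
  finally have "typeI_domain r \<union> Gr_topology r frontier_of typeI_domain r \<subseteq> kernel_free r M"
    using Q dom by blast
  moreover have "Gr_holomorphic_on r (\<lambda>P. (*v) M ` P) (kernel_free r M)"
    by (rule Gr_holomorphic_on_image)
  moreover have "\<forall>P\<in>typeI_domain r. (*v) M ` P = f P" using M by (auto simp: induces_def)
  ultimately show ?thesis unfolding Gr_holomorphic_on_def by blast
qed

end
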